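(* Let $G$ be both a groupoid and a topological space (no compatibility assumed) with Hausdorff unit space $G^0$, let $Y$ be a unital $1$-cancellative semigroup, and let $A\subseteq{}_Y\mathcal{O}(G)$ be a semigroup whose product is given by $ab(gh)=a(g)b(h)$ whenever $\mathrm{dom}(a)$ or $\mathrm{dom}(b)$ is a bisection. Let $Z,S,N\subseteq A$ be the subsets defined in the context. If $S=N$ and $S$ is $Z$-bumpy, then $\mathsf{N}(Z)=\{a\in A:aZ=Za\}$ is also $Z$-bumpy.
   Context: For a groupoid $G$: $\mathsf{s}(g)=g^{-1}g$, $\mathsf{r}(g)=gg^{-1}$; $G^0$ is the set of units; $gh$ is defined iff $\mathsf{s}(g)=\mathsf{r}(h)$; for $X,X'\subseteq G$, $XX'=\{xx':x\in X,x'\in X',\mathsf{s}(x)=\mathsf{r}(x')\}$ and $X^{-1}=\{x^{-1}:x\in X\}$. $\mathcal{O}(G)$ is the topology of $G$; $\mathrm{int}$ denotes interior in $G$. A bisection is $B\subseteq G$ with $BB^{-1}\cup B^{-1}B\subseteq G^0$; $\mathcal{B}^\circ(G)$ is the set of open bisections. $G^{\mathrm{iso}}=\{g\in G:\mathsf{s}(g)=\mathsf{r}(g)\}$; an isosection is $I\subseteq G$ with $II^{-1}\cup I^{-1}I\subseteq G^{\mathrm{iso}}$. A unital semigroup $Y$ is $1$-cancellative if for all $x,y\in Y$: $xy=x\Leftrightarrow y=1\Leftrightarrow yx=x$. $Y^\times$ is its set of invertible elements and $\mathsf{Z}(Y)$ its centre. For a family $\mathcal{X}$ of subsets of $G$,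 ${}_Y\mathcal{X}$ is the set of partial functions $a$ from $G$ to $Y$ with domain $\mathrm{dom}(a)\in\mathcal{X}$; $\mathrm{ran}(a)$ is the range; for $W\subseteq Y$, $[W]a=\{g\in\mathrm{dom}(a):a(g)\in W\}$, $[1]a=[\{1\}]a$. The assumption on $A$: it is a set of partial functions with open domains carrying an associative product such that, whenever $\mathrm{dom}(a)$ or $\mathrm{dom}(b)$ is a bisection, $ab$ is the function with domain $\mathrm{dom}(a)\mathrm{dom}(b)$ given by $ab(gh)=a(g)b(h)$ for $g\in\mathrm{dom}(a)$, $h\in\mathrm{dom}(b)$, $\mathsf{s}(g)=\mathsf{r}(h)$. (Nothing but associativity is assumed about other products.) Subsets of $A$: $Z=\{a\in A:\mathrm{dom}(a)\subseteq G^0,\ \mathrm{ran}(a)\subseteq\mathsf{Z}(Y)\}$; $S=\{a\in A:\mathrm{dom}(a)\text{ is a bisection}\}$; $N=\{a\in A:\mathrm{dom}(a)\text{ is an isosection}\}$. A subset $T\subseteq{}_Y\mathcal{B}^\circ(G)$ is bumpy if: (1-Proper) $[1]a$ is compact for all $a\in T$; (Urysohn) the empty function is in $T$, and whenever $g\in O\in\mathcal{O}(G)$ there is $a\in T$ with $\mathrm{dom}(a)\subseteq O$ and $g\in\mathrm{int}([Y^\times]a)$; (Involutive) whenever $a\in T$ and $g\in\mathrm{int}([Y^\times]a)$, there is $b\in T$ with $g^{-1}\in\mathrm{int}(\{h\in G:a(h^{-1})=b(h)^{-1}\})$. A subset $T\subseteq A\cap{}_Y\mathcal{B}^\circ(G)$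 is $Z$-bumpy if it is bumpy and, moreover, ($Z$-Involutive) whenever $a\in T$ and $g\in\mathrm{int}([Y^\times]a)$, there is $b\in T$ such that $ab,ba\in Z$ and $g^{-1}\in\mathrm{int}(\{h\in G:a(h^{-1})=b(h)^{-1}\})$. (In particular, the conclusion that $\mathsf{N}(Z)$ is $Z$-bumpy includes that its elements have bisection domains.) *)

theory Defs
  imports "HOL-Analysis.Analysis"
begin

section \<open>Groupoids\<close>

text \<open>
  The operations are total functions on the ambient type; only the products \<open>gcomp G g h\<close>
  with \<open>g\<close>, \<open>h\<close> arrows and \<open>gsource G g = grange G h\<close> are meaningful.
\<close>

record 'g groupoid_data =
  arrows :: "'g set"
  gcomp :: "'g \<Rightarrow> 'g \<Rightarrow> 'g"
  ginv :: "'g \<Rightarrow> 'g"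

definition gsource :: "('g, 'm) groupoid_data_scheme \<Rightarrow> 'g \<Rightarrow> 'g" where
  "gsource G g = gcomp G (ginv G g) g"

definition grange :: "('g, 'm) groupoid_data_scheme \<Rightarrow> 'g \<Rightarrow> 'g" where
  "grange G g = gcomp G g (ginv G g)"

text \<open>
  A groupoid is a small category with arrow set \<open>arrows G\<close>, objects identified with their
  identity arrows, in which every arrow is invertible. The axioms \<open>source_inv\<close> and
  \<open>range_inv\<close> say that \<open>ginv G g\<close> is composable with \<open>g\<close> on either side; that each
  source or range is its own source and range follows.
\<close>

locale groupoid =
  fixes G :: "('g, 'm) groupoid_data_scheme"
  assumes inv_closed: "g \<in> arrows G \<Longrightarrow> ginv G g \<in> arrows G"
    and source_inv: "g \<in> arrows G \<Longrightarrow> gsource G (ginv G g) = grange G g"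
    and range_inv: "g \<in> arrows G \<Longrightarrow> grange G (ginv G g) = gsource G g"
    and comp_closed: "\<lbrakk>g \<in> arrows G; h \<in> arrows G; gsource G g = grange G h\<rbrakk>
          \<Longrightarrow> gcomp G g h \<in> arrows G"
    and source_comp: "\<lbrakk>g \<in> arrows G; h \<in> arrows G; gsource G g = grange G h\<rbrakk>
          \<Longrightarrow> gsource G (gcomp G g h) = gsource G h"
    and range_comp: "\<lbrakk>g \<in> arrows G; h \<in> arrows G; gsource G g = grange G h\<rbrakk>
          \<Longrightarrow> grange G (gcomp G g h) = grange G g"
    and comp_assoc: "\<lbrakk>g \<in> arrows G; h \<in> arrows G; k \<in> arrows G;
            gsource G g = grange G h; gsource G h = grange G k\<rbrakk>
          \<Longrightarrow> gcomp G (gcomp G g h) k = gcomp G g (gcomp G h k)"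
    and comp_source: "g \<in> arrows G \<Longrightarrow> gcomp G g (gsource G g) = g"
    and range_comp_self: "g \<in> arrows G \<Longrightarrow> gcomp G (grange G g) g = g"

definition gunits :: "('g, 'm) groupoid_data_scheme \<Rightarrow> 'g set" where
  "gunits G = gsource G ` arrows G"

definition giso :: "('g, 'm) groupoid_data_scheme \<Rightarrow> 'g set" where
  "giso G = {g \<in> arrows G. gsource G g = grange G g}"

definition gset_mult :: "('g, 'm) groupoid_data_scheme \<Rightarrow> 'g set \<Rightarrow> 'g set \<Rightarrow> 'g set" where
  "gset_mult G U V = {gcomp G u v | u v. u \<in> U \<and> v \<in> V \<and> gsource G u = grange G v}"

definition gset_inv :: "('g, 'm) groupoid_data_scheme \<Rightarrow> 'g set \<Rightarrow> 'g set" where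
  "gset_inv G U = ginv G ` U"

definition bisection :: "('g, 'm) groupoid_data_scheme \<Rightarrow> 'g set \<Rightarrow> bool" where
  "bisection G B \<longleftrightarrow> B \<subseteq> arrows G \<and>
     gset_mult G B (gset_inv G B) \<union> gset_mult G (gset_inv G B) B \<subseteq> gunits G"

definition isosection :: "('g, 'm) groupoid_data_scheme \<Rightarrow> 'g set \<Rightarrow> bool" where
  "isosection G I \<longleftrightarrow> I \<subseteq> arrows G \<and>
     gset_mult G I (gset_inv G I) \<union> gset_mult G (gset_inv G I) I \<subseteq> giso G"

section \<open>Unital semigroups\<close>

definition one_cancellative :: "'y::monoid_mult itself \<Rightarrow> bool" where
  "one_cancellative _ \<longleftrightarrow>
     (\<forall>x y::'y. (x * y = x \<longleftrightarrow> y = 1) \<and> (y = 1 \<longleftrightarrow> y * x = x))"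

definition invertibles :: "'y::monoid_mult set" where
  "invertibles = {y. \<exists>x. x * y = 1 \<and> y * x = 1}"

text \<open>Only meaningful for \<open>y \<in> invertibles\<close>, where the inverse is unique.\<close>

definition monoid_inverse :: "'y::monoid_mult \<Rightarrow> 'y" where
  "monoid_inverse y = (THE x. x * y = 1 \<and> y * x = 1)"

definition centre :: "'y::monoid_mult set" where
  "centre = {y. \<forall>x. x * y = y * x}"

section \<open>Partial functions on a groupoid\<close>

definition partial_functions :: "'g set set \<Rightarrow> ('g \<rightharpoonup> 'y) set" where
  "partial_functions \<X> = {a. dom a \<in> \<X>}"

definition open_bisections :: "('g, 'm) groupoid_data_scheme \<Rightarrow> 'g topology \<Rightarrow> 'g set set" where
  "open_bisections G X = {B. openin X B \<and> bisection G B}"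

definition value_preimage :: "'y set \<Rightarrow> ('g \<rightharpoonup> 'y) \<Rightarrow> 'g set" where
  "value_preimage W a = {g \<in> dom a. the (a g) \<in> W}"

text \<open>
  The set of \<open>h\<close> with \<open>a(h\<inverse>) = b(h)\<inverse>\<close>: both sides are required to be defined, so
  \<open>h\<inverse>\<close> lies in the domain of \<open>a\<close>, \<open>h\<close> in that of \<open>b\<close>, and \<open>b(h)\<close> is invertible.
\<close>

definition inverse_locus ::
  "('g, 'm) groupoid_data_scheme \<Rightarrow> ('g \<rightharpoonup> 'y::monoid_mult) \<Rightarrow> ('g \<rightharpoonup> 'y) \<Rightarrow> 'g set" where
  "inverse_locus G a b =
     {h \<in> arrows G. ginv G h \<in> dom a \<and> h \<in> dom b \<and> the (b h) \<in> invertibles \<and>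
        the (a (ginv G h)) = monoid_inverse (the (b h))}"

text \<open>
  The product \<open>p\<close> is prescribed only when one of the two domains is a bisection. Outside \<open>A\<close>
  its values are irrelevant.
\<close>

definition pf_semigroup ::
  "('g, 'm) groupoid_data_scheme \<Rightarrow> 'g topology \<Rightarrow> ('g \<rightharpoonup> 'y::monoid_mult) set \<Rightarrow>
   (('g \<rightharpoonup> 'y) \<Rightarrow> ('g \<rightharpoonup> 'y) \<Rightarrow> ('g \<rightharpoonup> 'y)) \<Rightarrow> bool" where
  "pf_semigroup G X A p \<longleftrightarrow>
     A \<subseteq> partial_functions {U. openin X U} \<and>
     (\<forall>a\<in>A. \<forall>b\<in>A. p a b \<in> A) \<and>
     (\<forall>a\<in>A. \<forall>b\<in>A. \<forall>c\<in>A. p (p a b) c = p a (p b c)) \<and>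
     (\<forall>a\<in>A. \<forall>b\<in>A. bisection G (dom a) \<or> bisection G (dom b) \<longrightarrow>
        dom (p a b) = gset_mult G (dom a) (dom b) \<and>
        (\<forall>g\<in>dom a. \<forall>h\<in>dom b. gsource G g = grange G h \<longrightarrow>
           p a b (gcomp G g h) = Some (the (a g) * the (b h))))"

definition Z_part ::
  "('g, 'm) groupoid_data_scheme \<Rightarrow> ('g \<rightharpoonup> 'y::monoid_mult) set \<Rightarrow> ('g \<rightharpoonup> 'y) set" where
  "Z_part G A = {a \<in> A. dom a \<subseteq> gunits G \<and> ran a \<subseteq> centre}"

definition S_part ::
  "('g, 'm) groupoid_data_scheme \<Rightarrow> ('g \<rightharpoonup> 'y) set \<Rightarrow> ('g \<rightharpoonup> 'y) set" where
  "S_part G A = {a \<in> A. bisection G (dom a)}"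

definition N_part ::
  "('g, 'm) groupoid_data_scheme \<Rightarrow> ('g \<rightharpoonup> 'y) set \<Rightarrow> ('g \<rightharpoonup> 'y) set" where
  "N_part G A = {a \<in> A. isosection G (dom a)}"

definition normalizer :: "'a set \<Rightarrow> ('a \<Rightarrow> 'a \<Rightarrow> 'a) \<Rightarrow> 'a set \<Rightarrow> 'a set" where
  "normalizer A p Z = {a \<in> A. p a ` Z = (\<lambda>z. p z a) ` Z}"

section \<open>Bumpy families\<close>

definition one_proper :: "'g topology \<Rightarrow> ('g \<rightharpoonup> 'y::monoid_mult) set \<Rightarrow> bool" where
  "one_proper X T \<longleftrightarrow> (\<forall>a\<in>T. compactin X (value_preimage {1} a))"

definition urysohn :: "'g topology \<Rightarrow> ('g \<rightharpoonup> 'y::monoid_mult) set \<Rightarrow> bool" where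
  "urysohn X T \<longleftrightarrow> Map.empty \<in> T \<and>
     (\<forall>U g. openin X U \<and> g \<in> U \<longrightarrow>
        (\<exists>a\<in>T. dom a \<subseteq> U \<and> g \<in> X interior_of (value_preimage invertibles a)))"

definition involutive ::
  "('g, 'm) groupoid_data_scheme \<Rightarrow> 'g topology \<Rightarrow> ('g \<rightharpoonup> 'y::monoid_mult) set \<Rightarrow> bool" where
  "involutive G X T \<longleftrightarrow>
     (\<forall>a\<in>T. \<forall>g \<in> X interior_of (value_preimage invertibles a).
        \<exists>b\<in>T. ginv G g \<in> X interior_of (inverse_locus G a b))"

definition bumpy ::
  "('g, 'm) groupoid_data_scheme \<Rightarrow> 'g topology \<Rightarrow> ('g \<rightharpoonup> 'y::monoid_mult) set \<Rightarrow> bool" where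
  "bumpy G X T \<longleftrightarrow> T \<subseteq> partial_functions (open_bisections G X) \<and>
     one_proper X T \<and> urysohn X T \<and> involutive G X T"

definition Z_involutive ::
  "('g, 'm) groupoid_data_scheme \<Rightarrow> 'g topology \<Rightarrow> ('g \<rightharpoonup> 'y::monoid_mult) set \<Rightarrow>
   (('g \<rightharpoonup> 'y) \<Rightarrow> ('g \<rightharpoonup> 'y) \<Rightarrow> ('g \<rightharpoonup> 'y)) \<Rightarrow> ('g \<rightharpoonup> 'y) set \<Rightarrow> bool" where
  "Z_involutive G X A p T \<longleftrightarrow>
     (\<forall>a\<in>T. \<forall>g \<in> X interior_of (value_preimage invertibles a).
        \<exists>b\<in>T. p a b \<in> Z_part G A \<and> p b a \<in> Z_part G A \<and>
          ginv G g \<in> X interior_of (inverse_locus G a b))"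

definition Z_bumpy ::
  "('g, 'm) groupoid_data_scheme \<Rightarrow> 'g topology \<Rightarrow> ('g \<rightharpoonup> 'y::monoid_mult) set \<Rightarrow>
   (('g \<rightharpoonup> 'y) \<Rightarrow> ('g \<rightharpoonup> 'y) \<Rightarrow> ('g \<rightharpoonup> 'y)) \<Rightarrow> ('g \<rightharpoonup> 'y) set \<Rightarrow> bool" where
  "Z_bumpy G X A p T \<longleftrightarrow> T \<subseteq> A \<inter> partial_functions (open_bisections G X) \<and>
     bumpy G X T \<and> Z_involutive G X A p T"

end

theory Submission
  imports Defs
begin

text \<open>
  Urysohn and \<open>Z\<close>-Involutivity of \<open>S\<close> force the groupoid to be compatible with its topology.
  Domains of elements of \<open>S\<close> form a basis, \<open>h\<inverse>\<close> lies in \<open>dom a\<close> for \<open>h\<close> in an inverse locus of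
  \<open>a\<close>, and domains of products are open; hence inversion is continuous
  (\<open>ex_open_nbhd_inv_subset\<close>), products of open sets are open (\<open>openin_gset_mult\<close>) and the unit
  space is open (\<open>openin_gunits\<close>). Moreover \<open>Z\<close> contains functions with arbitrarily small support
  that are \<open>1\<close> near a given unit (\<open>ex_Z_part_one_near\<close>), namely products \<open>ab\<close> of an element of
  \<open>S\<close> supported on units with a local inverse.

  These functions separate units. If \<open>a\<close> normalizes \<open>Z\<close>, then \<open>za = az'\<close> turns a condition on
  ranges of arrows in \<open>dom a\<close> into a condition on their sources, so arrows of \<open>dom a\<close> with a common
  source have a common range, and conversely. Thus \<open>dom a\<close> is an isosection, and \<open>N = S\<close> makes it a
  bisection (\<open>normalizer_subset_S_part\<close>).

  In the other direction, let \<open>ab\<close> and \<open>ba\<close> lie in \<open>Z\<close>. Then \<open>z \<mapsto> azb\<close> and \<open>z \<mapsto> bza\<close> map \<open>Z\<close> to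
  itself, and where \<open>b\<close> is inverse to \<open>a\<close> they carry the value of \<open>z\<close> at one end of an arrow to the
  other end. Therefore every \<open>c\<close> in \<open>S\<close> supported where \<open>a\<close> and \<open>b\<close>, or \<open>b\<close> and \<open>a\<close>, are mutually
  inverse is a normalizer (\<open>local_inverse_support_normalizer\<close>). Elements of \<open>S\<close> with such small
  supports give Urysohn for the normalizer. For \<open>Z\<close>-Involutivity, a local inverse \<open>b \<in> S\<close> of a
  normalizer \<open>a\<close> is cut down to \<open>bz\<close>, where \<open>z \<in> Z\<close> is \<open>1\<close> near the source of \<open>g\<inverse>\<close> and supported so
  close to it that \<open>bz\<close> lives in the inverse locus.
\<close>

section \<open>Groupoid algebra\<close>

context groupoid
begin

lemma source_arrow: "g \<in> arrows G \<Longrightarrow> gsource G g \<in> arrows G"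
  unfolding gsource_def by (simp add: comp_closed inv_closed source_inv)

lemma source_unit: "g \<in> arrows G \<Longrightarrow> gsource G g \<in> gunits G"
  by (simp add: gunits_def)

lemma range_unit: "g \<in> arrows G \<Longrightarrow> grange G g \<in> gunits G"
  using source_unit[of "ginv G g"] by (simp add: source_inv inv_closed)

lemma unit_arrow: "x \<in> gunits G \<Longrightarrow> x \<in> arrows G"
  using source_arrow by (auto simp: gunits_def)

lemma source_of_unit: "x \<in> gunits G \<Longrightarrow> gsource G x = x"
proof -
  assume "x \<in> gunits G"
  then obtain g where g: "g \<in> arrows G" "x = gsource G g"
    by (auto simp: gunits_def)
  then show ?thesis
    using source_comp[of "ginv G g" g] by (simp add: inv_closed source_inv flip: gsource_def)
qed

lemma range_of_unit: "x \<in> gunits G \<Longrightarrow> grange G x = x"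
proof -
  assume "x \<in> gunits G"
  then obtain g where g: "g \<in> arrows G" "x = gsource G g"
    by (auto simp: gunits_def)
  then show ?thesis
    using range_comp[of "ginv G g" g]
    by (simp add: inv_closed source_inv range_inv flip: gsource_def)
qed

lemma inv_of_unit: "x \<in> gunits G \<Longrightarrow> ginv G x = x"
proof -
  assume x: "x \<in> gunits G"
  have "gcomp G (ginv G x) x = ginv G x"
    using comp_source[of "ginv G x"] x
    by (simp add: unit_arrow inv_closed source_inv range_of_unit)
  moreover have "gcomp G (ginv G x) x = x"
    using source_of_unit[OF x] by (simp add: gsource_def)
  ultimately show ?thesis by simp
qed

lemma inv_unique:
  assumes u: "u \<in> arrows G" and v: "v \<in> arrows G" and uv: "gsource G u = grange G v"
    and unit: "gcomp G u v \<in> gunits G"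
  shows "v = ginv G u"
proof -
  have prod: "gcomp G u v = grange G u"
    using range_comp[OF u v uv] range_of_unit[OF unit] by simp
  have "gcomp G (ginv G u) (gcomp G u v) = gcomp G (gcomp G (ginv G u) u) v"
    using comp_assoc[of "ginv G u" u v] u v uv by (simp add: inv_closed source_inv)
  also have "\<dots> = v"
    using uv range_comp_self[OF v] by (simp flip: gsource_def)
  finally show ?thesis
    using comp_source[of "ginv G u"] u prod by (simp add: inv_closed source_inv)
qed

lemma inv_inv: "g \<in> arrows G \<Longrightarrow> ginv G (ginv G g) = g"
  using inv_unique[of "ginv G g" g] source_unit[of g]
  by (simp add: inv_closed source_inv flip: gsource_def)

text \<open>
  The product \<open>gh\<inverse>\<close> of arrows with a common source is a unit only for \<open>g = h\<close>, by uniqueness of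
  inverses, and likewise for \<open>g\<inverse>h\<close> and ranges.
\<close>

lemma bisection_iff_inj_on:
  "bisection G B \<longleftrightarrow>
     B \<subseteq> arrows G \<and> inj_on (gsource G) B \<and> inj_on (grange G) B"
proof
  assume B: "bisection G B"
  then have sub: "B \<subseteq> arrows G" by (simp add: bisection_def)
  have "g = h" if "g \<in> B" "h \<in> B" "gsource G g = gsource G h" for g h
  proof -
    have gh: "g \<in> arrows G" "h \<in> arrows G" using that sub by auto
    have "gcomp G g (ginv G h) \<in> gset_mult G B (gset_inv G B)"
      using that gh by (force simp: gset_mult_def gset_inv_def range_inv)
    then have "gcomp G g (ginv G h) \<in> gunits G" using B by (auto simp: bisection_def)
    then have "ginv G h = ginv G g"
      using inv_unique[of g "ginv G h"] gh that by (simp add: inv_closed range_inv)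
    then show ?thesis using gh by (metis inv_inv)
  qed
  moreover have "g = h" if "g \<in> B" "h \<in> B" "grange G g = grange G h" for g h
  proof -
    have gh: "g \<in> arrows G" "h \<in> arrows G" using that sub by auto
    have "gcomp G (ginv G g) h \<in> gset_mult G (gset_inv G B) B"
      using that gh by (force simp: gset_mult_def gset_inv_def source_inv)
    then have "gcomp G (ginv G g) h \<in> gunits G" using B by (auto simp: bisection_def)
    then show ?thesis
      using inv_unique[of "ginv G g" h] gh that by (simp add: inv_closed source_inv inv_inv)
  qed
  ultimately show "B \<subseteq> arrows G \<and> inj_on (gsource G) B \<and> inj_on (grange G) B"
    using sub by (auto simp: inj_on_def)
next
  assume B: "B \<subseteq> arrows G \<and> inj_on (gsource G) B \<and> inj_on (grange G) B"
  have "gcomp G g (ginv G h) \<in> gunits G"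
    if "g \<in> B" "h \<in> B" "gsource G g = grange G (ginv G h)" for g h
  proof -
    have "g \<in> arrows G" "h \<in> arrows G" using that B by auto
    moreover from this have "g = h" using that B by (auto simp: range_inv inj_on_def)
    ultimately show ?thesis using range_unit[of h] by (simp add: grange_def)
  qed
  moreover have "gcomp G (ginv G g) h \<in> gunits G"
    if "g \<in> B" "h \<in> B" "gsource G (ginv G g) = grange G h" for g h
  proof -
    have "g \<in> arrows G" "h \<in> arrows G" using that B by auto
    moreover from this have "g = h" using that B by (auto simp: source_inv inj_on_def)
    ultimately show ?thesis using source_unit[of h] by (simp add: gsource_def)
  qed
  ultimately show "bisection G B"
    using B by (auto simp: bisection_def gset_mult_def gset_inv_def)
qed

lemma isosectionI:
  assumes sub: "I \<subseteq> arrows G"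
    and s: "\<And>g h. \<lbrakk>g \<in> I; h \<in> I; gsource G g = gsource G h\<rbrakk> \<Longrightarrow> grange G g = grange G h"
    and r: "\<And>g h. \<lbrakk>g \<in> I; h \<in> I; grange G g = grange G h\<rbrakk> \<Longrightarrow> gsource G g = gsource G h"
  shows "isosection G I"
proof -
  have "gcomp G g (ginv G h) \<in> giso G"
    if "g \<in> I" "h \<in> I" "gsource G g = grange G (ginv G h)" for g h
  proof -
    have "g \<in> arrows G" "h \<in> arrows G" using that sub by auto
    then show ?thesis
      using that s[of g h]
      by (simp add: giso_def comp_closed inv_closed source_comp range_comp source_inv range_inv)
  qed
  moreover have "gcomp G (ginv G g) h \<in> giso G"
    if "g \<in> I" "h \<in> I" "gsource G (ginv G g) = grange G h" for g h
  proof -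
    have "g \<in> arrows G" "h \<in> arrows G" using that sub by auto
    then show ?thesis
      using that r[of g h]
      by (simp add: giso_def comp_closed inv_closed source_comp range_comp source_inv range_inv)
  qed
  ultimately show ?thesis
    using sub by (auto simp: isosection_def gset_mult_def gset_inv_def)
qed

lemma gset_mult_mono: "\<lbrakk>U \<subseteq> U'; V \<subseteq> V'\<rbrakk> \<Longrightarrow> gset_mult G U V \<subseteq> gset_mult G U' V'"
  unfolding gset_mult_def by blast

lemma unit_subset_bisection: "U \<subseteq> gunits G \<Longrightarrow> bisection G U"
  by (auto simp: bisection_iff_inj_on inj_on_def subset_eq unit_arrow source_of_unit range_of_unit)

lemma gset_mult_units_left:
  assumes "U \<subseteq> gunits G" "V \<subseteq> arrows G"
  shows "gset_mult G U V = {k \<in> V. grange G k \<in> U}"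
proof -
  have "gcomp G u v = v \<and> grange G v \<in> U"
    if "u \<in> U" "v \<in> V" "gsource G u = grange G v" for u v
    using that assms source_of_unit[of u] range_comp_self[of v] by (metis subsetD)
  moreover have "k \<in> gset_mult G U V" if "k \<in> V" "grange G k \<in> U" for k
  proof -
    have "k = gcomp G (grange G k) k" "gsource G (grange G k) = grange G k"
      using that assms source_of_unit[of "grange G k"] range_comp_self[of k] by auto
    then show ?thesis
      unfolding gset_mult_def using that
      by (intro CollectI exI[of _ "grange G k"] exI[of _ k]) simp
  qed
  ultimately show ?thesis by (auto simp: gset_mult_def)
qed

lemma gset_mult_units_right:
  assumes "U \<subseteq> gunits G" "V \<subseteq> arrows G"
  shows "gset_mult G V U = {k \<in> V. gsource G k \<in> U}"
proof -
  have "gcomp G v u = v \<and> gsource G v \<in> U"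
    if "u \<in> U" "v \<in> V" "gsource G v = grange G u" for u v
    using that assms range_of_unit[of u] comp_source[of v] by (metis subsetD)
  moreover have "k \<in> gset_mult G V U" if "k \<in> V" "gsource G k \<in> U" for k
  proof -
    have "k = gcomp G k (gsource G k)" "grange G (gsource G k) = gsource G k"
      using that assms range_of_unit[of "gsource G k"] comp_source[of k] by auto
    then show ?thesis
      unfolding gset_mult_def using that
      by (intro CollectI exI[of _ k] exI[of _ "gsource G k"]) simp
  qed
  ultimately show ?thesis by (auto simp: gset_mult_def)
qed

end

lemma monoid_inverse_both:
  fixes y :: "'y::monoid_mult"
  assumes "y \<in> invertibles"
  shows "monoid_inverse y * y = 1" "y * monoid_inverse y = 1"
proof -
  obtain x where x: "x * y = 1" "y * x = 1" using assms by (auto simp: invertibles_def)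
  have "monoid_inverse y = x"
    unfolding monoid_inverse_def
  proof (rule the_equality)
    show "x' = x" if "x' * y = 1 \<and> y * x' = 1" for x'
      using that x by (metis mult.assoc mult.left_neutral mult.right_neutral)
  qed (use x in simp)
  then show "monoid_inverse y * y = 1" "y * monoid_inverse y = 1" using x by auto
qed

lemma inverse_locusD:
  assumes "h \<in> inverse_locus G a b"
  shows "h \<in> arrows G" "ginv G h \<in> dom a" "h \<in> dom b"
    "the (a (ginv G h)) * the (b h) = 1" "the (b h) * the (a (ginv G h)) = 1"
  using assms monoid_inverse_both by (auto simp: inverse_locus_def)

lemma centre_mult: "\<lbrakk>x \<in> centre; y \<in> centre\<rbrakk> \<Longrightarrow> x * y \<in> centre"
  for x y :: "'y::monoid_mult"
proof -
  assume xy: "x \<in> centre" "y \<in> centre"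
  have "w * (x * y) = (x * y) * w" for w
  proof -
    have "w * x = x * w" "w * y = y * w" using xy by (auto simp: centre_def)
    then show ?thesis by (metis mult.assoc)
  qed
  then show ?thesis unfolding centre_def by blast
qed

section \<open>Products of partial functions\<close>

locale groupoid_pf_semigroup = groupoid G
  for G :: "('g, 'm) groupoid_data_scheme" +
  fixes X :: "'g topology"
    and A :: "('g \<rightharpoonup> 'y::monoid_mult) set"
    and p :: "('g \<rightharpoonup> 'y) \<Rightarrow> ('g \<rightharpoonup> 'y) \<Rightarrow> ('g \<rightharpoonup> 'y)"
  assumes topspace: "topspace X = arrows G"
    and pf_semigroup: "pf_semigroup G X A p"
begin

abbreviation Z where "Z \<equiv> Z_part G A"
abbreviation S where "S \<equiv> S_part G A"

lemma openin_dom: "a \<in> A \<Longrightarrow> openin X (dom a)"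
  using pf_semigroup by (auto simp: pf_semigroup_def partial_functions_def)

lemma dom_arrows: "a \<in> A \<Longrightarrow> dom a \<subseteq> arrows G"
  using openin_dom openin_subset topspace by blast

lemma prod_in: "\<lbrakk>a \<in> A; b \<in> A\<rbrakk> \<Longrightarrow> p a b \<in> A"
  using pf_semigroup by (auto simp: pf_semigroup_def)

lemma dom_prod:
  "\<lbrakk>a \<in> A; b \<in> A; bisection G (dom a) \<or> bisection G (dom b)\<rbrakk>
    \<Longrightarrow> dom (p a b) = gset_mult G (dom a) (dom b)"
  using pf_semigroup unfolding pf_semigroup_def by blast

lemma prod_apply:
  "\<lbrakk>a \<in> A; b \<in> A; bisection G (dom a) \<or> bisection G (dom b);
    g \<in> dom a; h \<in> dom b; gsource G g = grange G h\<rbrakk>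
    \<Longrightarrow> p a b (gcomp G g h) = Some (the (a g) * the (b h))"
  using pf_semigroup unfolding pf_semigroup_def by blast

lemma S_partD: "a \<in> S \<Longrightarrow> a \<in> A" "a \<in> S \<Longrightarrow> bisection G (dom a)"
  by (auto simp: S_part_def)

lemma Z_partD: "z \<in> Z \<Longrightarrow> z \<in> A" "z \<in> Z \<Longrightarrow> dom z \<subseteq> gunits G"
  by (auto simp: Z_part_def)

lemma Z_part_bisection: "z \<in> Z \<Longrightarrow> bisection G (dom z)"
  using Z_partD(2) by (rule unit_subset_bisection)

lemma Z_part_central: "z \<in> Z \<Longrightarrow> x \<in> dom z \<Longrightarrow> the (z x) \<in> centre"
  by (auto simp: Z_part_def ran_def)

lemma Z_part_commute: "z \<in> Z \<Longrightarrow> x \<in> dom z \<Longrightarrow> the (z x) * y = y * the (z x)"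
  using Z_part_central by (force simp: centre_def)

lemma dom_Z_prod_left:
  assumes "z \<in> Z" "a \<in> A"
  shows "dom (p z a) = {k \<in> dom a. grange G k \<in> dom z}"
  using dom_prod[of z a] gset_mult_units_left[OF Z_partD(2) dom_arrows] assms
  by (simp add: Z_partD Z_part_bisection)

lemma dom_Z_prod_right:
  assumes "z \<in> Z" "a \<in> A"
  shows "dom (p a z) = {k \<in> dom a. gsource G k \<in> dom z}"
  using dom_prod[of a z] gset_mult_units_right[OF Z_partD(2) dom_arrows] assms
  by (simp add: Z_partD Z_part_bisection)

lemma Z_prod_left_apply:
  assumes "z \<in> Z" "a \<in> A" "k \<in> dom a" "grange G k \<in> dom z"
  shows "p z a k = Some (the (z (grange G k)) * the (a k))"
proof -
  have k: "k \<in> arrows G" using assms dom_arrows by auto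
  show ?thesis
    using prod_apply[of z a "grange G k" k] assms range_comp_self[OF k]
      source_of_unit[OF range_unit[OF k]]
    by (simp add: Z_partD Z_part_bisection)
qed

lemma Z_prod_right_apply:
  assumes "z \<in> Z" "a \<in> A" "k \<in> dom a" "gsource G k \<in> dom z"
  shows "p a z k = Some (the (a k) * the (z (gsource G k)))"
proof -
  have k: "k \<in> arrows G" using assms dom_arrows by auto
  show ?thesis
    using prod_apply[of a z k "gsource G k"] assms comp_source[OF k]
      range_of_unit[OF source_unit[OF k]]
    by (simp add: Z_partD Z_part_bisection)
qed

text \<open>
  The values of \<open>cz\<close> and \<open>wc\<close> at \<open>k\<close> are \<open>c(k) z(s(k))\<close> and \<open>w(r(k)) c(k)\<close>. As \<open>z\<close> has central
  values, they agree as soon as \<open>w(r(k)) = z(s(k))\<close>.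
\<close>

lemma Z_prod_eqI:
  assumes "z \<in> Z" "w \<in> Z" "c \<in> A"
    and dom_iff: "\<And>k. k \<in> dom c \<Longrightarrow> grange G k \<in> dom w \<longleftrightarrow> gsource G k \<in> dom z"
    and eq: "\<And>k. \<lbrakk>k \<in> dom c; gsource G k \<in> dom z\<rbrakk> \<Longrightarrow> w (grange G k) = z (gsource G k)"
  shows "p c z = p w c"
proof (rule map_le_antisym)
  have doms: "dom (p c z) = dom (p w c)"
    using assms by (auto simp: dom_Z_prod_left dom_Z_prod_right)
  have agree: "p c z k = p w c k" if "k \<in> dom (p c z)" for k
  proof -
    have k: "k \<in> dom c" "gsource G k \<in> dom z"
      using that assms by (auto simp: dom_Z_prod_right)
    then show ?thesis
      using assms Z_part_commute[of z "gsource G k" "the (c k)"]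
      by (simp add: Z_prod_left_apply Z_prod_right_apply)
  qed
  show "p c z \<subseteq>\<^sub>m p w c" "p w c \<subseteq>\<^sub>m p c z"
    using agree doms by (auto simp: map_le_def)
qed

lemma conjugate_eq:
  assumes "a \<in> S" "b \<in> S" "z \<in> Z"
  shows "dom (p (p a z) b) =
      {gcomp G u v | u v. u \<in> dom a \<and> gsource G u \<in> dom z \<and> v \<in> dom b \<and> gsource G u = grange G v}"
    and "\<lbrakk>u \<in> dom a; gsource G u \<in> dom z; v \<in> dom b; gsource G u = grange G v\<rbrakk>
      \<Longrightarrow> p (p a z) b (gcomp G u v) = Some (the (z (gsource G u)) * (the (a u) * the (b v)))"
proof -
  have az: "p a z \<in> A" using assms S_partD Z_partD prod_in by auto
  have dom_az: "dom (p a z) = {u \<in> dom a. gsource G u \<in> dom z}"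
    using assms dom_Z_prod_right S_partD by auto
  show "dom (p (p a z) b) =
      {gcomp G u v | u v. u \<in> dom a \<and> gsource G u \<in> dom z \<and> v \<in> dom b \<and> gsource G u = grange G v}"
    using dom_prod[OF az, of b] assms S_partD by (auto simp: dom_az gset_mult_def)
  show "p (p a z) b (gcomp G u v) = Some (the (z (gsource G u)) * (the (a u) * the (b v)))"
    if "u \<in> dom a" "gsource G u \<in> dom z" "v \<in> dom b" "gsource G u = grange G v"
  proof -
    have "p (p a z) b (gcomp G u v) = Some (the (p a z u) * the (b v))"
      using prod_apply[OF az, of b u v] assms S_partD that dom_az by auto
    also have "the (p a z u) = the (z (gsource G u)) * the (a u)"
      using Z_prod_right_apply[of z a u] Z_part_commute[of z "gsource G u" "the (a u)"] that assms S_partD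
      by auto
    finally show ?thesis by (simp add: mult.assoc)
  qed
qed

text \<open>
  Since \<open>z\<close> is central, \<open>azb\<close> has the values of \<open>ab\<close> multiplied by values of \<open>z\<close>, on a part of the
  domain of \<open>ab\<close>.
\<close>

lemma conjugate_in_Z_part:
  assumes "a \<in> S" "b \<in> S" "p a b \<in> Z" "z \<in> Z"
  shows "p (p a z) b \<in> Z"
proof -
  have "x \<in> gunits G \<and> the (p (p a z) b x) \<in> centre" if "x \<in> dom (p (p a z) b)" for x
  proof -
    from that[unfolded conjugate_eq(1)[OF assms(1,2,4)]]
    obtain u v where uv: "x = gcomp G u v" "u \<in> dom a" "gsource G u \<in> dom z" "v \<in> dom b"
        "gsource G u = grange G v"
      by blast
    have ab: "p a b x = Some (the (a u) * the (b v))"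
      using prod_apply[of a b u v] uv assms S_partD by auto
    then have "x \<in> dom (p a b)" by auto
    then have "x \<in> gunits G" "the (a u) * the (b v) \<in> centre"
      using assms Z_partD Z_part_central ab by force+
    then show ?thesis
      using conjugate_eq(2)[OF assms(1,2,4) uv(2-5)] uv(1)
        centre_mult[OF Z_part_central[OF assms(4) uv(3)]]
      by simp
  qed
  moreover have "p (p a z) b \<in> A" using assms S_partD Z_partD prod_in by auto
  ultimately show ?thesis by (force simp: Z_part_def ran_def)
qed

text \<open>
  If \<open>b\<close> inverts \<open>a\<close> at the arrow \<open>k\<close>, then conjugation by \<open>a\<close> moves the value of \<open>z\<close> from the source
  of \<open>k\<close> to its range. Injectivity of the range on \<open>dom a\<close> ensures that no other arrow contributes
  at that unit.
\<close>

lemma conjugate_at_range: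
  assumes "a \<in> S" "b \<in> S" "p a b \<in> Z" "z \<in> Z"
    and k: "k \<in> dom a" "ginv G k \<in> dom b" "the (a k) * the (b (ginv G k)) = 1"
  shows "p (p a z) b (grange G k) = z (gsource G k)"
proof (cases "gsource G k \<in> dom z")
  case True
  have "k \<in> arrows G" using k assms dom_arrows S_partD by blast
  then show ?thesis
    using conjugate_eq(2)[OF assms(1,2,4) k(1) True k(2)] True k
    by (auto simp: range_inv simp flip: grange_def)
next
  case False
  have kG: "k \<in> arrows G" using k assms dom_arrows S_partD by blast
  have "grange G k \<notin> dom (p (p a z) b)"
  proof
    assume "grange G k \<in> dom (p (p a z) b)"
    then obtain u v where uv: "grange G k = gcomp G u v" "u \<in> dom a" "gsource G u \<in> dom z" "v \<in> dom b"
        "gsource G u = grange G v"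
        unfolding conjugate_eq(1)[OF assms(1,2,4)] by blast
    have "u \<in> arrows G" "v \<in> arrows G" using uv assms dom_arrows S_partD by blast+
    then have "grange G u = grange G k"
      using range_comp[of u v] uv range_of_unit[OF range_unit[OF kG]] by simp
    moreover have "inj_on (grange G) (dom a)"
      using assms S_partD bisection_iff_inj_on by blast
    ultimately have "u = k" using uv(2) k(1) by (auto simp: inj_on_def)
    then show False using uv False by simp
  qed
  then show ?thesis using False by (simp add: domIff)
qed

text \<open>
  For a \<open>z\<close> on either side of \<open>c\<close>, one of the conjugates \<open>azb\<close> and \<open>bza\<close> is the element of \<open>Z\<close> that
  has to appear on the other side.
\<close>

lemma local_inverse_support_normalizer:
  assumes "a \<in> S" "b \<in> S" "p a b \<in> Z" "p b a \<in> Z" and c: "c \<in> A"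
    and supp: "\<And>k. k \<in> dom c \<Longrightarrow> k \<in> dom a \<and> ginv G k \<in> dom b \<and>
      the (a k) * the (b (ginv G k)) = 1 \<and> the (b (ginv G k)) * the (a k) = 1"
  shows "c \<in> normalizer A p Z"
proof -
  have "p c z \<in> (\<lambda>z. p z c) ` Z" if z: "z \<in> Z" for z
  proof -
    have "p c z = p (p (p a z) b) c"
    proof (rule Z_prod_eqI)
      show "p (p a z) b \<in> Z" using conjugate_in_Z_part assms z by blast
      have eq: "p (p a z) b (grange G k) = z (gsource G k)" if "k \<in> dom c" for k
        using conjugate_at_range[of a b z k] assms z that by blast
      then show "grange G k \<in> dom (p (p a z) b) \<longleftrightarrow> gsource G k \<in> dom z" if "k \<in> dom c" for k
        using that by (simp add: domIff)
      show "p (p a z) b (grange G k) = z (gsource G k)" if "k \<in> dom c" "gsource G k \<in> dom z" for k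
        using eq that by blast
    qed (use z c in auto)
    then show ?thesis using conjugate_in_Z_part assms z by blast
  qed
  moreover have "p z c \<in> p c ` Z" if z: "z \<in> Z" for z
  proof -
    have "p c (p (p b z) a) = p z c"
    proof (rule Z_prod_eqI)
      show "p (p b z) a \<in> Z" using conjugate_in_Z_part assms z by blast
      have eq: "p (p b z) a (gsource G k) = z (grange G k)" if k: "k \<in> dom c" for k
      proof -
        have kG: "k \<in> arrows G" using k c dom_arrows by blast
        have "ginv G (ginv G k) = k" using kG by (rule inv_inv)
        then have "p (p b z) a (grange G (ginv G k)) = z (gsource G (ginv G k))"
          using conjugate_at_range[of b a z "ginv G k"] assms z supp[OF k] by simp
        then show ?thesis using kG by (simp add: range_inv source_inv)
      qed
      then show "grange G k \<in> dom z \<longleftrightarrow> gsource G k \<in> dom (p (p b z) a)" if "k \<in> dom c" for k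
        using that by (simp add: domIff)
      show "z (grange G k) = p (p b z) a (gsource G k)"
        if "k \<in> dom c" "gsource G k \<in> dom (p (p b z) a)" for k
        using eq that by simp
    qed (use z c in auto)
    then show ?thesis using conjugate_in_Z_part assms z by (metis imageI)
  qed
  ultimately show ?thesis using c by (auto simp: normalizer_def)
qed

end

section \<open>Topological consequences of bumpiness\<close>

locale Z_bumpy_semigroup = groupoid_pf_semigroup G X A p
  for G :: "('g, 'm) groupoid_data_scheme" and X :: "'g topology"
    and A :: "('g \<rightharpoonup> 'y::monoid_mult) set" and p +
  assumes S_Z_bumpy: "Z_bumpy G X A p (S_part G A)"
begin

lemma empty_in_S: "Map.empty \<in> S"
  using S_Z_bumpy by (simp add: Z_bumpy_def bumpy_def urysohn_def)

lemma urysohnE: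
  assumes "openin X U" "g \<in> U"
  obtains a where "a \<in> S" "dom a \<subseteq> U" "g \<in> X interior_of value_preimage invertibles a" "g \<in> dom a"
proof -
  obtain a where a: "a \<in> S" "dom a \<subseteq> U" "g \<in> X interior_of value_preimage invertibles a"
    using S_Z_bumpy assms unfolding Z_bumpy_def bumpy_def urysohn_def by blast
  moreover have "X interior_of value_preimage invertibles a \<subseteq> dom a"
    using interior_of_subset[of X "value_preimage invertibles a"] by (auto simp: value_preimage_def)
  ultimately have "g \<in> dom a" by blast
  with a that show thesis by blast
qed

lemma local_inverseE:
  assumes "a \<in> S" "g \<in> X interior_of value_preimage invertibles a"
  obtains b L where "b \<in> S" "p a b \<in> Z" "p b a \<in> Z" "openin X L" "ginv G g \<in> L"
    "L \<subseteq> inverse_locus G a b"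
proof -
  obtain b where "b \<in> S" "p a b \<in> Z" "p b a \<in> Z" "ginv G g \<in> X interior_of inverse_locus G a b"
    using S_Z_bumpy assms unfolding Z_bumpy_def Z_involutive_def by blast
  then show thesis using that openin_interior_of interior_of_subset by metis
qed

text \<open>
  A function supported in \<open>U\<close> and invertible near \<open>g\<inverse>\<close> has a local inverse near \<open>g\<close>; at every arrow
  of its inverse locus the original function is defined at the inverse arrow, which thus lies
  in \<open>U\<close>.
\<close>

lemma ex_open_nbhd_inv_subset:
  assumes "openin X U" "g \<in> arrows G" "ginv G g \<in> U"
  obtains V where "openin X V" "g \<in> V" "ginv G ` V \<subseteq> U"
proof -
  obtain a where a: "a \<in> S" "dom a \<subseteq> U" "ginv G g \<in> X interior_of value_preimage invertibles a"
    by (rule urysohnE[OF assms(1,3)])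
  obtain b V where V: "openin X V" "ginv G (ginv G g) \<in> V" "V \<subseteq> inverse_locus G a b"
    by (rule local_inverseE[OF a(1,3)])
  show thesis
  proof (rule that)
    show "openin X V" by (rule V)
    show "g \<in> V" using V(2) inv_inv[OF assms(2)] by simp
    show "ginv G ` V \<subseteq> U"
    proof
      fix k assume "k \<in> ginv G ` V"
      then obtain h where "k = ginv G h" "h \<in> inverse_locus G a b" using V(3) by blast
      then show "k \<in> U" using inverse_locusD(2)[of h G a b] a(2) by blast
    qed
  qed
qed

text \<open>
  Elements of \<open>S\<close> with supports in \<open>U\<close> and \<open>V\<close> that are defined at \<open>u\<close> and \<open>v\<close> have a product whose
  domain is open, contains \<open>uv\<close> and lies in \<open>UV\<close>.
\<close>

lemma openin_gset_mult:
  assumes "openin X U" "openin X V"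
  shows "openin X (gset_mult G U V)"
proof (subst openin_subopen, intro ballI)
  fix k assume "k \<in> gset_mult G U V"
  then obtain u v where k: "k = gcomp G u v" "u \<in> U" "v \<in> V" "gsource G u = grange G v"
    by (auto simp: gset_mult_def)
  obtain a where a: "a \<in> S" "dom a \<subseteq> U" "u \<in> dom a" by (rule urysohnE[OF assms(1) k(2)])
  obtain b where b: "b \<in> S" "dom b \<subseteq> V" "v \<in> dom b" by (rule urysohnE[OF assms(2) k(3)])
  have dom_ab: "dom (p a b) = gset_mult G (dom a) (dom b)" using dom_prod a b S_partD by blast
  show "\<exists>T. openin X T \<and> k \<in> T \<and> T \<subseteq> gset_mult G U V"
  proof (intro exI conjI)
    show "openin X (dom (p a b))" using prod_in openin_dom a b S_partD by blast
    show "k \<in> dom (p a b)" unfolding dom_ab gset_mult_def using k a(3) b(3) by blast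
    show "dom (p a b) \<subseteq> gset_mult G U V" unfolding dom_ab by (rule gset_mult_mono[OF a(2) b(2)])
  qed
qed

text \<open>
  If \<open>b\<close> inverts \<open>a\<close> near a unit \<open>x\<close>, then \<open>ab\<close> is defined at \<open>x\<close> and has an open domain consisting
  of units.
\<close>

lemma openin_gunits: "openin X (gunits G)"
proof (subst openin_subopen, intro ballI)
  fix x assume x: "x \<in> gunits G"
  then have "x \<in> topspace X" using unit_arrow topspace by simp
  then obtain a where a: "a \<in> S" "x \<in> X interior_of value_preimage invertibles a" "x \<in> dom a"
    by (rule urysohnE[OF openin_topspace])
  obtain b L where b: "b \<in> S" "p a b \<in> Z" "ginv G x \<in> L" "L \<subseteq> inverse_locus G a b"
    by (rule local_inverseE[OF a(1,2)])
  have "x \<in> inverse_locus G a b" using b(3,4) inv_of_unit[OF x] by auto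
  then have "x \<in> dom b" by (rule inverse_locusD(3))
  then have "p a b (gcomp G x x) = Some (the (a x) * the (b x))"
    using prod_apply[of a b x x] a b S_partD x by (simp add: source_of_unit range_of_unit)
  moreover have "gcomp G x x = x"
    using comp_source[OF unit_arrow[OF x]] source_of_unit[OF x] by simp
  ultimately have "x \<in> dom (p a b)" by auto
  then show "\<exists>T. openin X T \<and> x \<in> T \<and> T \<subseteq> gunits G"
    using openin_dom[OF Z_partD(1)[OF b(2)]] Z_partD(2)[OF b(2)] by blast
qed

text \<open>
  Choosing \<open>a\<close> supported on units of \<open>U\<close> keeps the domain of \<open>ab\<close> inside \<open>U\<close>, and \<open>ab\<close> is \<open>1\<close> wherever
  \<open>b\<close> inverts \<open>a\<close>.
\<close>

lemma ex_Z_part_one_near: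
  assumes x: "x \<in> gunits G" and U: "openin X U" "x \<in> U"
  obtains z W where "z \<in> Z" "dom z \<subseteq> U" "openin X W" "x \<in> W" "W \<subseteq> gunits G"
    "\<forall>y\<in>W. z y = Some 1"
proof -
  have "openin X (U \<inter> gunits G)" "x \<in> U \<inter> gunits G"
    using x U openin_gunits by auto
  then obtain a where a: "a \<in> S" "dom a \<subseteq> U \<inter> gunits G"
      "x \<in> X interior_of value_preimage invertibles a"
    by (rule urysohnE)
  obtain b L where b: "b \<in> S" "p a b \<in> Z" "openin X L" "ginv G x \<in> L" "L \<subseteq> inverse_locus G a b"
    by (rule local_inverseE[OF a(1,3)])
  have "k \<in> U" if "k \<in> dom (p a b)" for k
  proof -
    have "dom (p a b) = gset_mult G (dom a) (dom b)" using dom_prod a b S_partD by blast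
    with that have "k \<in> gset_mult G (dom a) (dom b)" by blast
    then obtain u v where k: "k = gcomp G u v" "u \<in> dom a" "v \<in> dom b" "gsource G u = grange G v"
      unfolding gset_mult_def by blast
    have u: "u \<in> gunits G" "u \<in> U" using k a by auto
    have v: "v \<in> arrows G" using k b dom_arrows S_partD by blast
    have "k \<in> gunits G" using that b Z_partD by blast
    then have "k = grange G k" by (simp add: range_of_unit)
    also have "\<dots> = u"
      using range_comp[OF unit_arrow[OF u(1)] v k(4)] k(1) range_of_unit[OF u(1)] by simp
    finally show ?thesis using u by simp
  qed
  then have "dom (p a b) \<subseteq> U" by blast
  moreover have "p a b y = Some 1" if y: "y \<in> L \<inter> gunits G" for y
  proof -
    have unit: "y \<in> gunits G" and "y \<in> inverse_locus G a b" using y b by auto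
    note inverse_locusD[OF this(2)]
    then have "y \<in> dom a" "y \<in> dom b" "the (a y) * the (b y) = 1"
      unfolding inv_of_unit[OF unit] by simp_all
    moreover have "gcomp G y y = y"
      using comp_source[OF unit_arrow[OF unit]] source_of_unit[OF unit] by simp
    ultimately show ?thesis
      using prod_apply[of a b y y] S_partD[OF a(1)] S_partD[OF b(1)]
      by (simp add: source_of_unit range_of_unit unit)
  qed
  moreover have "openin X (L \<inter> gunits G)" "x \<in> L \<inter> gunits G"
    using b x openin_gunits inv_of_unit by auto
  ultimately show thesis using that[of "p a b" "L \<inter> gunits G"] b by blast
qed

section \<open>Bumpiness of the normalizer\<close>

text \<open>
  Elements of \<open>Z\<close> separate units, and the equations \<open>za = az'\<close> and \<open>az = z'a\<close> relate membership of
  ranges and sources of arrows of \<open>dom a\<close> in domains of elements of \<open>Z\<close>. Hence \<open>dom a\<close> is an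
  isosection.
\<close>

lemma normalizer_subset_S_part:
  assumes haus: "Hausdorff_space (subtopology X (gunits G))" and SN: "S_part G A = N_part G A"
  shows "normalizer A p Z \<subseteq> S"
proof
  fix a assume norm: "a \<in> normalizer A p Z"
  then have a: "a \<in> A" and comm: "p a ` Z = (\<lambda>z. p z a) ` Z" by (auto simp: normalizer_def)
  have sep: "\<exists>z\<in>Z. x \<in> dom z \<and> y \<notin> dom z"
    if xy: "x \<in> gunits G" "y \<in> gunits G" "x \<noteq> y" for x y
  proof -
    have "x \<in> topspace (subtopology X (gunits G))" "y \<in> topspace (subtopology X (gunits G))"
      using xy unit_arrow topspace by auto
    then obtain U V where "openin (subtopology X (gunits G)) U" "x \<in> U" "y \<in> V" "disjnt U V"
      using haus xy unfolding Hausdorff_space_def by metis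
    moreover from this have "openin X U" using openin_gunits openin_trans_full by blast
    ultimately show ?thesis
      by (metis disjnt_iff domIff ex_Z_part_one_near[OF xy(1)] option.distinct(1) subsetD)
  qed
  have "isosection G (dom a)"
  proof (rule isosectionI)
    show "dom a \<subseteq> arrows G" using a dom_arrows by blast
    fix g h assume gh: "g \<in> dom a" "h \<in> dom a"
    then have ghG: "g \<in> arrows G" "h \<in> arrows G" using a dom_arrows by auto
    show "grange G g = grange G h" if s: "gsource G g = gsource G h"
    proof (rule ccontr)
      assume "grange G g \<noteq> grange G h"
      then obtain z where z: "z \<in> Z" "grange G g \<in> dom z" "grange G h \<notin> dom z"
        using sep ghG range_unit by blast
      then obtain z' where z': "z' \<in> Z" "p z a = p a z'" using comm by blast
      have eq: "{k \<in> dom a. grange G k \<in> dom z} = {k \<in> dom a. gsource G k \<in> dom z'}"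
        using dom_Z_prod_left[OF z(1) a] dom_Z_prod_right[OF z'(1) a] z'(2) by simp
      then have "gsource G g \<in> dom z'" using z(2) gh by blast
      then have "h \<in> {k \<in> dom a. gsource G k \<in> dom z'}" using gh s by simp
      then show False unfolding eq[symmetric] using z(3) by simp
    qed
    show "gsource G g = gsource G h" if r: "grange G g = grange G h"
    proof (rule ccontr)
      assume "gsource G g \<noteq> gsource G h"
      then obtain z where z: "z \<in> Z" "gsource G g \<in> dom z" "gsource G h \<notin> dom z"
        using sep ghG source_unit by blast
      then obtain z' where z': "z' \<in> Z" "p a z = p z' a" using comm by blast
      have eq: "{k \<in> dom a. gsource G k \<in> dom z} = {k \<in> dom a. grange G k \<in> dom z'}"
        using dom_Z_prod_right[OF z(1) a] dom_Z_prod_left[OF z'(1) a] z'(2) by simp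
      then have "grange G g \<in> dom z'" using z(2) gh by blast
      then have "h \<in> {k \<in> dom a. grange G k \<in> dom z'}" using gh r by simp
      then show False unfolding eq[symmetric] using z(3) by simp
    qed
  qed
  then show "a \<in> S" using a SN by (simp add: N_part_def)
qed

lemma empty_in_normalizer: "Map.empty \<in> normalizer A p Z"
proof -
  have "Map.empty \<in> Z" using empty_in_S by (simp add: Z_part_def S_part_def)
  then show ?thesis
    using local_inverse_support_normalizer[of Map.empty Map.empty Map.empty] empty_in_S
      dom_Z_prod_left[of Map.empty Map.empty] S_partD by force
qed

text \<open>
  Continuity of inversion gives a neighbourhood of \<open>g\<close> whose inverse lies in an inverse locus, and
  an element of \<open>S\<close> with support in this neighbourhood normalizes \<open>Z\<close>.
\<close>

lemma urysohn_normalizer: "urysohn X (normalizer A p Z)"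
  unfolding urysohn_def
proof (intro conjI allI impI)
  fix U g assume U: "openin X U \<and> g \<in> U"
  then have g: "g \<in> arrows G" using openin_subset topspace by blast
  obtain a where a: "a \<in> S" "g \<in> X interior_of value_preimage invertibles a"
    using U by (auto intro: urysohnE)
  obtain b L where b: "b \<in> S" "p a b \<in> Z" "p b a \<in> Z" "openin X L" "ginv G g \<in> L"
      "L \<subseteq> inverse_locus G a b"
    by (rule local_inverseE[OF a])
  obtain V where V: "openin X V" "g \<in> V" "ginv G ` V \<subseteq> L"
    by (rule ex_open_nbhd_inv_subset[OF b(4) g b(5)])
  have "openin X (U \<inter> V)" "g \<in> U \<inter> V" using U V by auto
  then obtain c where c: "c \<in> S" "dom c \<subseteq> U \<inter> V"
      "g \<in> X interior_of value_preimage invertibles c"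
    by (rule urysohnE)
  have "c \<in> normalizer A p Z"
  proof (rule local_inverse_support_normalizer[OF a(1) b(1-3) S_partD(1)[OF c(1)]])
    fix k assume k: "k \<in> dom c"
    then have "ginv G (ginv G k) = k"
      using inv_inv dom_arrows[OF S_partD(1)[OF c(1)]] by blast
    moreover have "ginv G k \<in> inverse_locus G a b" using k c V b by blast
    ultimately show "k \<in> dom a \<and> ginv G k \<in> dom b \<and>
        the (a k) * the (b (ginv G k)) = 1 \<and> the (b (ginv G k)) * the (a k) = 1"
      using inverse_locusD[of "ginv G k" G a b] by simp
  qed
  then show "\<exists>a\<in>normalizer A p Z. dom a \<subseteq> U \<and> g \<in> X interior_of value_preimage invertibles a"
    using c by blast
qed (rule empty_in_normalizer)

lemma Z_part_prod_Z_part: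
  assumes "w \<in> Z" "z \<in> Z"
  shows "p w z \<in> Z"
proof -
  have "x \<in> gunits G \<and> the (p w z x) \<in> centre" if "x \<in> dom (p w z)" for x
  proof -
    have x: "x \<in> dom w" "gsource G x \<in> dom z"
      using that assms dom_Z_prod_right Z_partD by auto
    have "x \<in> gunits G" using x(1) Z_partD(2)[OF assms(1)] by blast
    then show ?thesis
      using centre_mult[OF Z_part_central[OF assms(1) x(1)] Z_part_central[OF assms(2) x(2)]]
      by (simp add: Z_prod_right_apply[OF assms(2) Z_partD(1)[OF assms(1)] x])
  qed
  moreover have "p w z \<in> A" using assms Z_partD(1) prod_in by blast
  ultimately show ?thesis by (force simp: Z_part_def ran_def)
qed

text \<open>
  A local inverse need not normalize \<open>Z\<close> itself, because nothing controls it away from its inverse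
  locus; multiplication by a suitable \<open>z \<in> Z\<close> removes that part of its support.
\<close>

lemma Z_involutive_S_part_normalizer:
  assumes a: "a \<in> S" and g: "g \<in> X interior_of value_preimage invertibles a"
  obtains b where "b \<in> normalizer A p Z" "p a b \<in> Z" "p b a \<in> Z"
    "ginv G g \<in> X interior_of inverse_locus G a b"
proof -
  obtain b L where b: "b \<in> S" "p a b \<in> Z" "p b a \<in> Z" "openin X L" "ginv G g \<in> L"
      "L \<subseteq> inverse_locus G a b"
    by (rule local_inverseE[OF a g])
  have gG: "g \<in> arrows G" using subsetD[OF interior_of_subset_topspace g] topspace by simp
  have LG: "L \<subseteq> arrows G" using openin_subset[OF b(4)] topspace by simp
  have Lb: "L \<subseteq> dom b" using b(6) by (auto simp: inverse_locus_def)
  have inj_s: "inj_on (gsource G) (dom b)" and inj_r: "inj_on (grange G) (dom b)"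
    using S_partD(2)[OF b(1)] by (simp_all add: bisection_iff_inj_on)
  obtain M where M: "openin X M" "g \<in> M" "ginv G ` M \<subseteq> L"
    by (rule ex_open_nbhd_inv_subset[OF b(4) gG b(5)])
  \<comment> \<open>As \<open>L\<close> is a bisection containing \<open>M\<inverse>\<close>, the open set \<open>ML\<close> consists of sources of arrows of \<open>L\<close>.\<close>
  have V: "openin X (gset_mult G M L)" using M b openin_gset_mult by blast
  have V_sub: "gset_mult G M L \<subseteq> gsource G ` L"
  proof
    fix x assume "x \<in> gset_mult G M L"
    then obtain m l where x: "x = gcomp G m l" "m \<in> M" "l \<in> L" "gsource G m = grange G l"
      by (auto simp: gset_mult_def)
    have m: "m \<in> arrows G" using x(2) openin_subset[OF M(1)] topspace by blast
    have "grange G (ginv G m) = grange G l" using x(4) range_inv[OF m] by simp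
    moreover have "ginv G m \<in> dom b" "l \<in> dom b" using x M(3) Lb by auto
    ultimately have "ginv G m = l" using inj_r by (auto dest: inj_onD)
    then have "x = gsource G l" using x(1) inv_inv[OF m] by (simp add: gsource_def)
    then show "x \<in> gsource G ` L" using x by blast
  qed
  have r: "grange G g \<in> gunits G" "grange G g \<in> gset_mult G M L"
  proof -
    show "grange G g \<in> gunits G" by (rule range_unit[OF gG])
    have "grange G g = gcomp G g (ginv G g)" "gsource G g = grange G (ginv G g)"
      using range_inv[OF gG] by (simp_all add: grange_def)
    then show "grange G g \<in> gset_mult G M L" unfolding gset_mult_def using M(2) b(5) by blast
  qed
  obtain z W where z: "z \<in> Z" "dom z \<subseteq> gset_mult G M L" "openin X W" "grange G g \<in> W"
      "W \<subseteq> gunits G" "\<forall>y\<in>W. z y = Some 1"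
    by (rule ex_Z_part_one_near[OF r(1) V r(2)])
  define c where "c = p b z"
  have c: "c \<in> A" using prod_in b z S_partD Z_partD by (simp add: c_def)
  have dom_c: "dom c = {l \<in> dom b. gsource G l \<in> dom z}"
    using dom_Z_prod_right b z S_partD by (simp add: c_def)
  have dom_c_L: "dom c \<subseteq> L"
  proof
    fix l assume "l \<in> dom c"
    then have l: "l \<in> dom b" "gsource G l \<in> gsource G ` L" using dom_c z(2) V_sub by auto
    then obtain l' where "l' \<in> L" "gsource G l = gsource G l'" by blast
    moreover from this l Lb have "l = l'" using inj_onD[OF inj_s] by blast
    ultimately show "l \<in> L" by simp
  qed
  have "c \<in> normalizer A p Z"
  proof (rule local_inverse_support_normalizer[OF b(1) a b(3) b(2) c])
    fix l assume "l \<in> dom c"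
    then show "l \<in> dom b \<and> ginv G l \<in> dom a \<and>
        the (b l) * the (a (ginv G l)) = 1 \<and> the (a (ginv G l)) * the (b l) = 1"
    proof -
      have "l \<in> inverse_locus G a b" using \<open>l \<in> dom c\<close> dom_c_L b(6) by blast
      note inverse_locusD[OF this]
      then show ?thesis by simp
    qed
  qed
  moreover have "p a c \<in> Z"
  proof -
    have "p a c = p (p a b) z"
      using pf_semigroup S_partD(1)[OF a] S_partD(1)[OF b(1)] Z_partD(1)[OF z(1)]
      unfolding c_def pf_semigroup_def by simp
    then show ?thesis using Z_part_prod_Z_part b z by simp
  qed
  moreover have "p c a \<in> Z"
    using conjugate_in_Z_part[OF b(1) a b(3) z(1)] by (simp add: c_def)
  moreover have "ginv G g \<in> X interior_of inverse_locus G a c"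
  proof -
    have LW: "gset_mult G L W = {l \<in> L. gsource G l \<in> W}"
      by (rule gset_mult_units_right[OF z(5) LG])
    have "{l \<in> L. gsource G l \<in> W} \<subseteq> inverse_locus G a c"
    proof clarify
      fix l assume l: "l \<in> L" "gsource G l \<in> W"
      then have "c l = Some (the (b l))"
        using Z_prod_right_apply[OF z(1) S_partD(1)[OF b(1)], of l] z(6) Lb by (auto simp: c_def)
      then show "l \<in> inverse_locus G a c"
        using l b(6) by (auto simp: inverse_locus_def)
    qed
    moreover have "openin X {l \<in> L. gsource G l \<in> W}"
      using openin_gset_mult[OF b(4) z(3)] by (simp add: LW)
    moreover have "ginv G g \<in> {l \<in> L. gsource G l \<in> W}"
      using b z source_inv[OF gG] by simp
    ultimately show ?thesis using interior_of_maximal by blast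
  qed
  ultimately show thesis using that by blast
qed

lemma Z_bumpy_normalizer:
  assumes "normalizer A p Z \<subseteq> S"
  shows "Z_bumpy G X A p (normalizer A p Z)"
proof -
  have S: "S \<subseteq> A \<inter> partial_functions (open_bisections G X)" "one_proper X S"
    using S_Z_bumpy by (simp_all only: Z_bumpy_def bumpy_def)
  have sub: "normalizer A p Z \<subseteq> A \<inter> partial_functions (open_bisections G X)"
    using assms S(1) by (rule subset_trans)
  then have sub': "normalizer A p Z \<subseteq> partial_functions (open_bisections G X)"
    by (rule order_trans[OF _ Int_lower2])
  have proper: "one_proper X (normalizer A p Z)"
    using S(2) subsetD[OF assms] by (simp add: one_proper_def)
  have Z_inv: "\<exists>b\<in>normalizer A p Z. p a b \<in> Z \<and> p b a \<in> Z \<and>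
      ginv G g \<in> X interior_of inverse_locus G a b"
    if a: "a \<in> normalizer A p Z" and g: "g \<in> X interior_of value_preimage invertibles a" for a g
  proof -
    obtain b where b: "b \<in> normalizer A p Z" "p a b \<in> Z" "p b a \<in> Z"
        "ginv G g \<in> X interior_of inverse_locus G a b"
      by (rule Z_involutive_S_part_normalizer[OF subsetD[OF assms a] g])
    show ?thesis by (intro bexI[OF _ b(1)] conjI b(2-4))
  qed
  then have "involutive G X (normalizer A p Z)"
    unfolding involutive_def by meson
  with sub' proper urysohn_normalizer have "bumpy G X (normalizer A p Z)"
    by (simp only: bumpy_def)
  moreover have "Z_involutive G X A p (normalizer A p Z)"
    unfolding Z_involutive_def using Z_inv by (intro ballI)
  ultimately show ?thesis
    unfolding Z_bumpy_def by (intro conjI sub)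
qed

end

theorem proposition6p6:
  fixes G :: "'g groupoid_data"
    and X :: "'g topology"
    and A :: "('g \<rightharpoonup> 'y::monoid_mult) set"
    and p :: "('g \<rightharpoonup> 'y) \<Rightarrow> ('g \<rightharpoonup> 'y) \<Rightarrow> ('g \<rightharpoonup> 'y)"
  assumes "groupoid G"
    and "topspace X = arrows G"
    and "Hausdorff_space (subtopology X (gunits G))"
    and "one_cancellative TYPE('y)"
    and "pf_semigroup G X A p"
    and "S_part G A = N_part G A"
    and "Z_bumpy G X A p (S_part G A)"
  shows "Z_bumpy G X A p (normalizer A p (Z_part G A))"
proof -
  interpret Z_bumpy_semigroup G X A p
    using assms
    by (intro Z_bumpy_semigroup.intro groupoid_pf_semigroup.intro
        groupoid_pf_semigroup_axioms.intro Z_bumpy_semigroup_axioms.intro)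
  show ?thesis
    by (rule Z_bumpy_normalizer[OF normalizer_subset_S_part[OF assms(3,6)]])
qed

end
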